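(* Let $S$ be a (countable) inverse semigroup that is a HIS. If $S$ is completely semisimple then $S$ is Clifford; otherwise $S$ is bisimple.
   Context: All structures are countable. An inverse semigroup is a semigroup in which every element $a$ has a unique $b$ (written $a^{-1}$) with $a=aba$ and $b=bab$. $S$ is a HIS (homogeneous inverse semigroup) if every isomorphism between finitely generated inverse subsemigroups of $S$ extends to an automorphism of $S$. $E(S)$ is the set of idempotents, a semilattice with natural order $e\le f \iff ef=e$. Green's relations on $S$: $a\,\mathcal R\,b\iff aa^{-1}=bb^{-1}$; $a\,\mathcal L\,b\iff a^{-1}a=b^{-1}b$; $a\,\mathcal D\,b$ iff there is $c\in S$ with $a\,\mathcal R\,c\,\mathcal L\,b$. $S$ is completely semisimple if no two distinct $\mathcal D$-related idempotents are comparable in the natural order on $E(S)$. $S$ is Clifford if $xx^{-1}=x^{-1}x$ for all $x\in S$. $S$ is bisimple if it has a single $\mathcal D$-class. *)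

theory Defs
  imports Main "HOL.Hull" "HOL-Library.Countable_Set"
begin

text \<open>An inverse semigroup \<open>S\<close> is an operation on a type, the type being the underlying set of
  \<open>S\<close>; in particular \<open>S\<close> is nonempty.\<close>

locale inverse_semigroup = semigroup mult
  for mult :: "'a \<Rightarrow> 'a \<Rightarrow> 'a" (infixl "\<^bold>*" 70) +
  assumes ex1_inverse: "\<exists>!b. a = a \<^bold>* b \<^bold>* a \<and> b = b \<^bold>* a \<^bold>* b"
begin

definition sinv :: "'a \<Rightarrow> 'a"
  where "sinv a = (THE b. a = a \<^bold>* b \<^bold>* a \<and> b = b \<^bold>* a \<^bold>* b)"

text \<open>The empty subset is allowed here. This does not affect homogeneity below, because the empty
  map extends to the identity automorphism.\<close>

definition inverse_subsemigroup :: "'a set \<Rightarrow> bool"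
  where "inverse_subsemigroup T \<longleftrightarrow> (\<forall>a\<in>T. \<forall>b\<in>T. a \<^bold>* b \<in> T) \<and> (\<forall>a\<in>T. sinv a \<in> T)"

definition finitely_generated :: "'a set \<Rightarrow> bool"
  where "finitely_generated T \<longleftrightarrow> (\<exists>X. finite X \<and> T = inverse_subsemigroup hull X)"

text \<open>Semigroup isomorphisms between inverse semigroups automatically preserve inverses.
  Only the values of \<open>f\<close> on \<open>A\<close> matter.\<close>

definition isomorphism :: "'a set \<Rightarrow> 'a set \<Rightarrow> ('a \<Rightarrow> 'a) \<Rightarrow> bool"
  where "isomorphism A B f \<longleftrightarrow>
    bij_betw f A B \<and> (\<forall>x\<in>A. \<forall>y\<in>A. f (x \<^bold>* y) = f x \<^bold>* f y)"

definition automorphism :: "('a \<Rightarrow> 'a) \<Rightarrow> bool"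
  where "automorphism g \<longleftrightarrow> isomorphism UNIV UNIV g"

definition HIS :: bool
  where "HIS \<longleftrightarrow> (\<forall>A B f. finitely_generated A \<and> finitely_generated B \<and> isomorphism A B f \<longrightarrow>
    (\<exists>g. automorphism g \<and> (\<forall>x\<in>A. g x = f x)))"

definition idempotents :: "'a set"
  where "idempotents = {e. e \<^bold>* e = e}"

definition natural_le :: "'a \<Rightarrow> 'a \<Rightarrow> bool"
  where "natural_le e f \<longleftrightarrow> f \<^bold>* e = e"

definition green_R :: "'a rel"
  where "green_R = {(a, b). a \<^bold>* sinv a = b \<^bold>* sinv b}"

definition green_L :: "'a rel"
  where "green_L = {(a, b). sinv a \<^bold>* a = sinv b \<^bold>* b}"

definition green_D :: "'a rel"
  where "green_D = {(a, b). \<exists>c. (a, c) \<in> green_R \<and> (c, b) \<in> green_L}"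

definition completely_semisimple :: bool
  where "completely_semisimple \<longleftrightarrow>
    (\<forall>e\<in>idempotents. \<forall>f\<in>idempotents. e \<noteq> f \<and> (e, f) \<in> green_D \<longrightarrow>
      \<not> natural_le e f \<and> \<not> natural_le f e)"

definition clifford :: bool
  where "clifford \<longleftrightarrow> (\<forall>x. x \<^bold>* sinv x = sinv x \<^bold>* x)"

definition bisimple :: bool
  where "bisimple \<longleftrightarrow> (\<exists>C. UNIV // green_D = {C})"

end

end

theory Submission
  imports Defs
begin

text \<open>
  Homogeneity makes the automorphism group transitive on idempotents, on strictly comparable pairs of
  idempotents and on incomparable pairs of idempotents. If two distinct comparable idempotents are
  \<open>\<D>\<close>-related, then so are any two comparable ones, and hence any \<open>e\<close> and \<open>f\<close>, through \<open>ef\<close>.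
  Otherwise every \<open>\<D>\<close>-class of idempotents is an antichain. If some class contained two elements
  \<open>e \<noteq> f\<close>, then any two incomparable idempotents would be \<open>\<D>\<close>-related; moving \<open>e\<close> to \<open>ef\<close> gives an
  idempotent \<open>h \<noteq> ef\<close> that is \<open>\<D>\<close>-related to \<open>ef\<close>. Being incomparable to \<open>ef\<close>, it is incomparable
  to \<open>e\<close> or to \<open>f\<close>, whence \<open>ef\<close> is \<open>\<D>\<close>-related to \<open>e\<close> or to \<open>f\<close>, although it lies below both.
\<close>

context inverse_semigroup
begin

section \<open>Inverses and the semilattice of idempotents\<close>

lemma mult_sinv_mult: "a \<^bold>* sinv a \<^bold>* a = a"
  and sinv_mult_sinv: "sinv a \<^bold>* a \<^bold>* sinv a = sinv a"
  using theI'[OF ex1_inverse[of a]] unfolding sinv_def by simp_all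

lemma sinv_unique:
  assumes "a \<^bold>* b \<^bold>* a = a" and "b \<^bold>* a \<^bold>* b = b"
  shows "sinv a = b"
  using ex1_inverse[of a] assms mult_sinv_mult[of a] sinv_mult_sinv[of a] by metis

lemma sinv_sinv [simp]: "sinv (sinv a) = a"
  by (rule sinv_unique) (fact sinv_mult_sinv mult_sinv_mult)+

lemma sinv_idempotent: "e \<in> idempotents \<Longrightarrow> sinv e = e"
  by (rule sinv_unique) (simp_all add: idempotents_def)

lemma mult_sinv_idempotent: "a \<^bold>* sinv a \<in> idempotents"
  and sinv_mult_idempotent: "sinv a \<^bold>* a \<in> idempotents"
  by (simp_all add: idempotents_def assoc [symmetric] mult_sinv_mult sinv_mult_sinv)

lemma idempotent_absorb: "e \<in> idempotents \<Longrightarrow> e \<^bold>* (e \<^bold>* a) = e \<^bold>* a"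
  by (simp add: idempotents_def assoc [symmetric])

text \<open>The inverse \<open>x\<close> of \<open>ef\<close> equals \<open>fxe\<close>, which is idempotent; hence so is \<open>ef\<close>.\<close>

lemma idempotents_closed:
  assumes e: "e \<in> idempotents" and f: "f \<in> idempotents"
  shows "e \<^bold>* f \<in> idempotents"
proof -
  define x where "x = sinv (e \<^bold>* f)"
  have efx: "e \<^bold>* (f \<^bold>* (x \<^bold>* (e \<^bold>* f))) = e \<^bold>* f"
    using mult_sinv_mult[of "e \<^bold>* f"] by (simp add: x_def assoc)
  have xef: "x \<^bold>* (e \<^bold>* (f \<^bold>* x)) = x"
    using sinv_mult_sinv[of "e \<^bold>* f"] by (simp add: x_def assoc)
  have xef': "x \<^bold>* (e \<^bold>* (f \<^bold>* (x \<^bold>* a))) = x \<^bold>* a" for a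
    using xef by (metis assoc)
  have x: "x = f \<^bold>* (x \<^bold>* e)"
    unfolding x_def
    by (rule sinv_unique)
      (simp_all add: x_def [symmetric] assoc idempotent_absorb e f efx xef')
  have "x \<^bold>* x = (f \<^bold>* (x \<^bold>* e)) \<^bold>* (f \<^bold>* (x \<^bold>* e))"
    by (rule arg_cong2[OF x x])
  also have "\<dots> = f \<^bold>* (x \<^bold>* e)"
    by (simp add: assoc xef')
  also have "\<dots> = x"
    by (rule x [symmetric])
  finally have "x \<in> idempotents"
    by (simp add: idempotents_def)
  moreover from this have "x = e \<^bold>* f"
    using sinv_idempotent sinv_sinv x_def by metis
  ultimately show ?thesis by simp
qed

text \<open>Both products are idempotent, which makes \<open>fe\<close> an inverse of
  \<open>ef\<close>. An idempotent is also its own inverse, so uniqueness identifies the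
  two.\<close>

lemma idempotents_commute:
  assumes e: "e \<in> idempotents" and f: "f \<in> idempotents"
  shows "e \<^bold>* f = f \<^bold>* e"
proof -
  have ef: "e \<^bold>* (f \<^bold>* (e \<^bold>* f)) = e \<^bold>* f" and fe: "f \<^bold>* (e \<^bold>* (f \<^bold>* e)) = f \<^bold>* e"
    using idempotents_closed[OF e f] idempotents_closed[OF f e] by (simp_all add: idempotents_def assoc)
  have "sinv (e \<^bold>* f) = f \<^bold>* e"
    by (rule sinv_unique) (simp_all add: assoc idempotent_absorb e f ef fe)
  then show ?thesis
    using sinv_idempotent[OF idempotents_closed[OF e f]] by simp
qed

lemma sinv_mult: "sinv (a \<^bold>* b) = sinv b \<^bold>* sinv a"
proof (rule sinv_unique)
  \<comment> \<open>The idempotents \<open>b b^-1\<close> and \<open>a^-1 a\<close> commute. The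
    arbitrary right factor \<open>c\<close> makes the equation applicable inside longer
    right-associated products.\<close>
  have comm: "b \<^bold>* (sinv b \<^bold>* (sinv a \<^bold>* (a \<^bold>* c))) = sinv a \<^bold>* (a \<^bold>* (b \<^bold>* (sinv b \<^bold>* c)))" for c
    using idempotents_commute[OF mult_sinv_idempotent[of b] sinv_mult_idempotent[of a]]
    by (metis assoc)
  have a: "a \<^bold>* (sinv a \<^bold>* (a \<^bold>* c)) = a \<^bold>* c" and b: "sinv b \<^bold>* (b \<^bold>* (sinv b \<^bold>* c)) = sinv b \<^bold>* c" for c
    using mult_sinv_mult[of a] sinv_mult_sinv[of b] by (metis assoc)+
  show "a \<^bold>* b \<^bold>* (sinv b \<^bold>* sinv a) \<^bold>* (a \<^bold>* b) = a \<^bold>* b"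
    using mult_sinv_mult[of b] by (simp add: assoc comm a)
  show "sinv b \<^bold>* sinv a \<^bold>* (a \<^bold>* b) \<^bold>* (sinv b \<^bold>* sinv a) = sinv b \<^bold>* sinv a"
    using sinv_mult_sinv[of a] by (simp add: assoc comm [symmetric] b)
qed

section \<open>Green's relation D, reduced to idempotents\<close>

lemma green_D_iff:
  "(a, b) \<in> green_D \<longleftrightarrow> (\<exists>c. c \<^bold>* sinv c = a \<^bold>* sinv a \<and> sinv c \<^bold>* c = sinv b \<^bold>* b)"
  by (simp add: green_D_def green_R_def green_L_def) metis

lemma green_D_idempotents_iff:
  assumes "e \<in> idempotents" "f \<in> idempotents"
  shows "(e, f) \<in> green_D \<longleftrightarrow> (\<exists>c. c \<^bold>* sinv c = e \<and> sinv c \<^bold>* c = f)"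
  using assms sinv_idempotent[of e] sinv_idempotent[of f] by (simp add: green_D_iff idempotents_def)

text \<open>Since \<open>a\<close> is R-related to \<open>a a^-1\<close> and \<open>b\<close> is
  L-related to \<open>b^-1 b\<close>, questions about \<open>green_D\<close> on all elements reduce
  to idempotents; bisimplicity is obtained this way.\<close>

lemma green_D_mult_sinv_iff: "(a \<^bold>* sinv a, sinv b \<^bold>* b) \<in> green_D \<longleftrightarrow> (a, b) \<in> green_D"
  using green_D_idempotents_iff[OF mult_sinv_idempotent sinv_mult_idempotent] green_D_iff by simp

lemma green_D_idempotents_sym:
  assumes "e \<in> idempotents" "f \<in> idempotents" "(e, f) \<in> green_D"
  shows "(f, e) \<in> green_D"
  \<comment> \<open>The inverse of a witness is a witness for the reversed pair.\<close>
  using assms by (metis green_D_idempotents_iff sinv_sinv)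

text \<open>Witnesses multiply: \<open>cd\<close> connects \<open>e\<close> to \<open>g\<close>,
  because the middle idempotent \<open>f\<close>, equal to both \<open>c^-1 c\<close> and
  \<open>d d^-1\<close>, is absorbed by its neighbours.\<close>

lemma green_D_idempotents_trans:
  assumes efg: "e \<in> idempotents" "f \<in> idempotents" "g \<in> idempotents"
    and "(e, f) \<in> green_D" and "(f, g) \<in> green_D"
  shows "(e, g) \<in> green_D"
proof -
  obtain c d where c: "c \<^bold>* sinv c = e" "sinv c \<^bold>* c = f" and d: "d \<^bold>* sinv d = f" "sinv d \<^bold>* d = g"
    using assms green_D_idempotents_iff by metis
  have "c \<^bold>* d \<^bold>* sinv (c \<^bold>* d) = c \<^bold>* (d \<^bold>* sinv d) \<^bold>* sinv c"
    by (simp add: sinv_mult assoc)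
  also have "\<dots> = e"
    using c d by (metis assoc mult_sinv_mult)
  finally have "c \<^bold>* d \<^bold>* sinv (c \<^bold>* d) = e" .
  moreover have "sinv (c \<^bold>* d) \<^bold>* (c \<^bold>* d) = sinv d \<^bold>* (sinv c \<^bold>* c) \<^bold>* d"
    by (simp add: sinv_mult assoc)
  then have "sinv (c \<^bold>* d) \<^bold>* (c \<^bold>* d) = g"
    using c d by (metis assoc mult_sinv_mult)
  ultimately show ?thesis
    using green_D_idempotents_iff efg by blast
qed

lemma bisimpleI:
  assumes "\<And>e f. e \<in> idempotents \<Longrightarrow> f \<in> idempotents \<Longrightarrow> (e, f) \<in> green_D"
  shows bisimple
proof -
  have "green_D = UNIV"
    using assms[OF mult_sinv_idempotent sinv_mult_idempotent] green_D_mult_sinv_iff by auto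
  then show ?thesis
    by (auto simp: bisimple_def quotient_def)
qed

section \<open>Automorphisms and homogeneity on finite semilattices\<close>

lemma automorphism_mult: "automorphism g \<Longrightarrow> g (a \<^bold>* b) = g a \<^bold>* g b"
  by (simp add: automorphism_def isomorphism_def)

lemma automorphism_sinv: "automorphism g \<Longrightarrow> g (sinv a) = sinv (g a)"
  by (rule sinv_unique [symmetric])
    (simp_all add: automorphism_mult [symmetric] mult_sinv_mult sinv_mult_sinv)

lemma automorphism_idempotent: "automorphism g \<Longrightarrow> e \<in> idempotents \<Longrightarrow> g e \<in> idempotents"
  by (simp add: idempotents_def automorphism_mult [symmetric])

lemma automorphism_eq_iff: "automorphism g \<Longrightarrow> g a = g b \<longleftrightarrow> a = b"
  by (auto simp: automorphism_def isomorphism_def bij_betw_def dest: injD)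

lemma automorphism_green_D:
  assumes "automorphism g" and "(a, b) \<in> green_D"
  shows "(g a, g b) \<in> green_D"
proof -
  obtain c where "c \<^bold>* sinv c = a \<^bold>* sinv a" "sinv c \<^bold>* c = sinv b \<^bold>* b"
    using assms(2) green_D_iff by blast
  then have "g c \<^bold>* sinv (g c) = g a \<^bold>* sinv (g a)" "sinv (g c) \<^bold>* g c = sinv (g b) \<^bold>* g b"
    using assms(1) by (simp_all flip: automorphism_mult automorphism_sinv)
  then show ?thesis
    unfolding green_D_iff by blast
qed

text \<open>Idempotents are their own inverses, so such a set is already an inverse subsemigroup and
  hence its own hull.\<close>

lemma finitely_generatedI:
  assumes "finite A" "A \<subseteq> idempotents" "\<And>a b. a \<in> A \<Longrightarrow> b \<in> A \<Longrightarrow> a \<^bold>* b \<in> A"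
  shows "finitely_generated A"
proof -
  have "inverse_subsemigroup A"
    using assms sinv_idempotent by (auto simp: inverse_subsemigroup_def subset_iff)
  then show ?thesis
    using hull_same assms(1) unfolding finitely_generated_def by metis
qed

text \<open>The form in which homogeneity is applied: an injective homomorphism from a finite
  semilattice of idempotents into the idempotents extends to an automorphism.\<close>

lemma HIS_extend:
  assumes HIS and "finite A" "A \<subseteq> idempotents" "\<And>a b. a \<in> A \<Longrightarrow> b \<in> A \<Longrightarrow> a \<^bold>* b \<in> A"
    and "\<phi> ` A \<subseteq> idempotents" "inj_on \<phi> A"
    and hom: "\<And>a b. a \<in> A \<Longrightarrow> b \<in> A \<Longrightarrow> \<phi> (a \<^bold>* b) = \<phi> a \<^bold>* \<phi> b"
  obtains g where "automorphism g" "\<And>a. a \<in> A \<Longrightarrow> g a = \<phi> a"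
proof -
  have "a \<^bold>* b \<in> \<phi> ` A" if "a \<in> \<phi> ` A" "b \<in> \<phi> ` A" for a b
    using that assms(4) hom by (metis (no_types, lifting) image_iff)
  then have "finitely_generated A" "finitely_generated (\<phi> ` A)" "isomorphism A (\<phi> ` A) \<phi>"
    using assms by (auto intro!: finitely_generatedI simp: isomorphism_def bij_betw_def)
  then show ?thesis
    using \<open>HIS\<close> that unfolding HIS_def by blast
qed

lemma HIS_move_idempotent:
  assumes HIS "e \<in> idempotents" "f \<in> idempotents"
  obtains g where "automorphism g" "g e = f"
  by (rule HIS_extend[of "{e}" "\<lambda>_. f"]) (use assms that in \<open>auto simp: idempotents_def\<close>)

lemma HIS_move_comparable:
  assumes HIS "e \<in> idempotents" "f \<in> idempotents" "natural_le e f" "e \<noteq> f"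
    and "e' \<in> idempotents" "f' \<in> idempotents" "natural_le e' f'" "e' \<noteq> f'"
  obtains g where "automorphism g" "g e = e'" "g f = f'"
proof -
  have le: "e \<^bold>* f = e" "f \<^bold>* e = e" "e' \<^bold>* f' = e'" "f' \<^bold>* e' = e'"
    using assms idempotents_commute by (auto simp: natural_le_def)
  show ?thesis
    by (rule HIS_extend[of "{e, f}" "\<lambda>x. if x = e then e' else f'"])
      (use assms that in \<open>auto simp: le idempotents_def\<close>)
qed

text \<open>Incomparability makes \<open>e\<close>, \<open>f\<close> and \<open>ef\<close> three
  distinct elements with a fixed multiplication table, so any two such triples are
  isomorphic.\<close>

lemma HIS_move_incomparable:
  assumes HIS "e \<in> idempotents" "f \<in> idempotents" "\<not> natural_le e f" "\<not> natural_le f e"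
    and "e' \<in> idempotents" "f' \<in> idempotents" "\<not> natural_le e' f'" "\<not> natural_le f' e'"
  obtains g where "automorphism g" "g e = e'" "g f = f'"
proof -
  \<comment> \<open>On the three distinct elements, the last branch is reached only at
    \<open>ef\<close>.\<close>
  define \<phi> where "\<phi> x = (if x = e then e' else if x = f then f' else e' \<^bold>* f')" for x
  have comm: "f \<^bold>* e = e \<^bold>* f" "f' \<^bold>* e' = e' \<^bold>* f'"
    using assms idempotents_commute by auto
  have ne: "e \<^bold>* f \<noteq> e" "e \<^bold>* f \<noteq> f" "e' \<^bold>* f' \<noteq> e'" "e' \<^bold>* f' \<noteq> f'"
    using assms comm by (auto simp: natural_le_def)
  have ne': "e \<noteq> f" "e' \<noteq> f'"
    using assms by (auto simp: natural_le_def idempotents_def)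
  have sq: "e \<^bold>* e = e" "f \<^bold>* f = f" "e' \<^bold>* e' = e'" "f' \<^bold>* f' = f'"
    using assms by (auto simp: idempotents_def)
  have absorb: "e \<^bold>* (e \<^bold>* f) = e \<^bold>* f" "f \<^bold>* (e \<^bold>* f) = e \<^bold>* f"
    "e' \<^bold>* (e' \<^bold>* f') = e' \<^bold>* f'" "f' \<^bold>* (e' \<^bold>* f') = e' \<^bold>* f'"
    using comm sq by (metis assoc)+
  have mult_ef: "e \<^bold>* f \<in> idempotents" "e' \<^bold>* f' \<in> idempotents"
    using assms idempotents_closed by auto
  have \<phi>: "\<phi> e = e'" "\<phi> f = f'" "\<phi> (e \<^bold>* f) = e' \<^bold>* f'"
    using ne ne' by (auto simp: \<phi>_def)
  show ?thesis
  proof (rule HIS_extend[of "{e, f, e \<^bold>* f}" \<phi>])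
    show "inj_on \<phi> {e, f, e \<^bold>* f}"
      using ne ne' \<phi> by (auto simp: inj_on_def)
    show "\<phi> (a \<^bold>* b) = \<phi> a \<^bold>* \<phi> b"
      if "a \<in> {e, f, e \<^bold>* f}" "b \<in> {e, f, e \<^bold>* f}" for a b
      using that unfolding insert_iff empty_iff
      by (elim disjE; simp add: \<phi> comm sq absorb assoc)
  qed (use assms(1,2,3,6,7) that in \<open>auto simp: \<phi> mult_ef comm sq absorb assoc\<close>)
qed

section \<open>Products as meets, and the two cases of the dichotomy\<close>

lemma natural_le_mult:
  assumes "e \<in> idempotents" "f \<in> idempotents"
  shows "natural_le (e \<^bold>* f) e" "natural_le (e \<^bold>* f) f"
  using assms idempotents_commute[OF assms] idempotent_absorb by (metis natural_le_def)+

lemma natural_le_trans: "natural_le e f \<Longrightarrow> natural_le f g \<Longrightarrow> natural_le e g"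
  unfolding natural_le_def by (metis assoc)

lemma natural_le_multI: "natural_le h e \<Longrightarrow> natural_le h f \<Longrightarrow> natural_le h (e \<^bold>* f)"
  by (simp add: natural_le_def assoc)

lemma HIS_not_completely_semisimple_bisimple:
  assumes HIS and "\<not> completely_semisimple"
  shows bisimple
proof (rule bisimpleI)
  \<comment> \<open>Symmetry of \<open>green_D\<close> on idempotents allows \<open>p\<close> to be
    taken as the smaller one.\<close>
  obtain p q where p: "p \<in> idempotents" and q: "q \<in> idempotents"
    and le: "natural_le p q" "p \<noteq> q" and pq: "(p, q) \<in> green_D"
    using assms(2) green_D_idempotents_sym unfolding completely_semisimple_def by metis
  have le_D: "(e, f) \<in> green_D"
    if ef: "e \<in> idempotents" "f \<in> idempotents" "natural_le e f" for e f
  proof (cases "e = f")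
    case True
    then show ?thesis by (auto simp: green_D_def green_R_def green_L_def)
  next
    case False
    then obtain g where "automorphism g" "g p = e" "g q = f"
      using HIS_move_comparable[OF \<open>HIS\<close> p q le ef] by blast
    then show ?thesis
      using automorphism_green_D pq by blast
  qed
  fix e f
  assume ef: "e \<in> idempotents" "f \<in> idempotents"
  then show "(e, f) \<in> green_D"
    using le_D natural_le_mult idempotents_closed green_D_idempotents_sym green_D_idempotents_trans
    by metis
qed

lemma HIS_completely_semisimple_clifford:
  assumes HIS and completely_semisimple
  shows clifford
proof (rule ccontr)
  assume "\<not> clifford"
  then obtain x where x: "x \<^bold>* sinv x \<noteq> sinv x \<^bold>* x"
    by (auto simp: clifford_def)
  define e f where "e = x \<^bold>* sinv x" and "f = sinv x \<^bold>* x"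
  have ef: "e \<in> idempotents" "f \<in> idempotents" "e \<noteq> f" "(e, f) \<in> green_D"
    using x mult_sinv_idempotent sinv_mult_idempotent green_D_idempotents_iff
    by (auto simp: e_def f_def)
  have antichain: "\<not> natural_le a b" "\<not> natural_le b a"
    if "a \<in> idempotents" "b \<in> idempotents" "a \<noteq> b" "(a, b) \<in> green_D" for a b
    using assms(2) that unfolding completely_semisimple_def by blast+
  have incomparable_D: "(a, b) \<in> green_D"
    if ab: "a \<in> idempotents" "b \<in> idempotents" "\<not> natural_le a b" "\<not> natural_le b a" for a b
  proof -
    obtain g where "automorphism g" "g e = a" "g f = b"
      using HIS_move_incomparable[OF \<open>HIS\<close> ef(1,2) antichain[OF ef] ab] .
    then show ?thesis
      using automorphism_green_D ef(4) by blast
  qed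
  define m where "m = e \<^bold>* f"
  have m: "m \<in> idempotents" "natural_le m e" "natural_le m f"
    using ef idempotents_closed natural_le_mult by (auto simp: m_def)
  have "m \<noteq> e" "m \<noteq> f"
    using antichain[OF ef] m by auto
  obtain g where g: "automorphism g" "g e = m"
    using HIS_move_idempotent[OF \<open>HIS\<close> ef(1) m(1)] .
  \<comment> \<open>As \<open>g\<close> sends the pair \<open>e\<close>, \<open>f\<close> to
    \<open>m\<close>, \<open>h\<close>, the new pair is again distinct and D-related.\<close>
  define h where "h = g f"
  have h: "h \<in> idempotents" "m \<noteq> h" "(m, h) \<in> green_D"
    using g ef automorphism_idempotent automorphism_eq_iff automorphism_green_D
    by (auto simp: h_def)
  have mh: "\<not> natural_le m h" "\<not> natural_le h m"
    using antichain[OF m(1) h] by auto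
  have comparable: "natural_le h a" if a: "a \<in> idempotents" "natural_le m a" "m \<noteq> a" for a
  proof (rule ccontr)
    assume "\<not> natural_le h a"
    \<comment> \<open>The relation \<open>a\<close> \<le> \<open>h\<close> is excluded as well: with
      \<open>m\<close> \<le> \<open>a\<close> it would give \<open>m\<close> \<le>
      \<open>h\<close>.\<close>
    then have "(h, a) \<in> green_D"
      using incomparable_D a(1,2) h(1) mh(1) natural_le_trans by blast
    then have "(m, a) \<in> green_D"
      using green_D_idempotents_trans h m(1) a(1) by blast
    then show False
      using antichain a m(1) by blast
  qed
  \<comment> \<open>\<open>h\<close> lies below both \<open>e\<close> and \<open>f\<close>, hence
    below their meet \<open>m\<close>, against \<open>mh\<close>.\<close>
  have "natural_le h m"
    using comparable[OF ef(1) m(2) \<open>m \<noteq> e\<close>] comparable[OF ef(2) m(3) \<open>m \<noteq> f\<close>] natural_le_multI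
    by (simp add: m_def)
  with mh show False by blast
qed

end

theorem theorem3p16:
  fixes mult :: "'a \<Rightarrow> 'a \<Rightarrow> 'a"
  assumes "countable (UNIV :: 'a set)"
    and "inverse_semigroup mult"
    and "inverse_semigroup.HIS mult"
  shows "(inverse_semigroup.completely_semisimple mult \<longrightarrow> inverse_semigroup.clifford mult) \<and>
    (\<not> inverse_semigroup.completely_semisimple mult \<longrightarrow> inverse_semigroup.bisimple mult)"
  using assms inverse_semigroup.HIS_completely_semisimple_clifford
    inverse_semigroup.HIS_not_completely_semisimple_bisimple by blast

end
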